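(* Let $\{X_n\}_{n\in\mathbb{N}}$ be a sequence of finite connected vertex-transitive graphs with uniformly bounded degree. Then $\{X_n\}_{n\in\mathbb{N}}$ is a sequence of asymptotic expanders if and only if it is a sequence of expanders.
   Context: Graphs are undirected, without loops or multiple edges, identified with their vertex sets and equipped with the path metric. A graph is vertex-transitive if its automorphism group acts transitively on vertices. For a metric space $(X,d)$, $A\subseteq X$ and $R>0$, let $\partial_R A=\{x\in X\setminus A : d(x,A)\le R\}$, and for a graph write $\partial A=\partial_1A$. A sequence $\{X_n\}_{n\in\mathbb{N}}$ of finite metric spaces is a sequence of asymptotic expanders if $|X_n|\to\infty$ and for every $\alpha\in(0,\frac12]$ there exist $c_\alpha\in(0,1)$ and $R_\alpha>0$ such that for every $n$ and every $A\subseteq X_n$ with $\alpha|X_n|\le|A|\le\frac12|X_n|$ we have $|\partial_{R_\alpha}A|>c_\alpha|A|$. A sequence $\{X_n\}$ of finite graphs with uniformly bounded degrees is a sequence of expanders if $|X_n|\to\infty$ and there is $c>0$ such that for every $n$ and every non-empty $A\subseteq X_n$ with $|A|\le\frac12|X_n|$ we have $|\partial A|>c|A|$. *)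

theory Defs
  imports "HOL-Analysis.Analysis" "Graph_Theory.Graph_Theory"
begin

text \<open>
  Graphs are the finite symmetric simple digraphs of the locale \<open>Digraph.graph\<close>; each undirected
  edge is a pair of opposite arcs, so \<open>out_degree\<close> is the usual degree.
\<close>

definition path_edist :: "('a, 'b) pre_digraph \<Rightarrow> 'a \<Rightarrow> 'a \<Rightarrow> ereal" where
  "path_edist G = wf_digraph.\<mu> G (\<lambda>_. 1)"

text \<open>
  Meaningful for connected graphs only: otherwise \<open>path_edist\<close> takes the value \<open>\<infinity>\<close>.
  See \<open>mspace_path_metric\<close> and \<open>mdist_path_metric\<close> below.
\<close>

definition path_metric :: "('a, 'b) pre_digraph \<Rightarrow> 'a metric" where
  "path_metric G = metric (verts G, \<lambda>u v. real_of_ereal (path_edist G u v))"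

text \<open>
  The infimum is taken in \<open>ereal\<close>, so the distance to the empty set is \<open>\<infinity>\<close> and the boundary of
  the empty set is empty.  The argument \<open>d\<close> is extended-real valued so that the boundary
  also makes sense in a disconnected graph.
\<close>

definition boundary :: "'a set \<Rightarrow> ('a \<Rightarrow> 'a \<Rightarrow> ereal) \<Rightarrow> real \<Rightarrow> 'a set \<Rightarrow> 'a set" where
  "boundary M d R A = {x \<in> M - A. (INF a\<in>A. d x a) \<le> ereal R}"

definition metric_boundary :: "'a metric \<Rightarrow> real \<Rightarrow> 'a set \<Rightarrow> 'a set" where
  "metric_boundary X = boundary (mspace X) (\<lambda>x y. ereal (mdist X x y))"

definition graph_boundary :: "('a, 'b) pre_digraph \<Rightarrow> 'a set \<Rightarrow> 'a set" where
  "graph_boundary G = boundary (verts G) (path_edist G) 1"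

definition asymptotic_expanders :: "(nat \<Rightarrow> 'a metric) \<Rightarrow> bool" where
  "asymptotic_expanders X \<longleftrightarrow>
     (\<forall>n. finite (mspace (X n))) \<and>
     filterlim (\<lambda>n. card (mspace (X n))) at_top sequentially \<and>
     (\<forall>\<alpha>\<in>{0<..1/2}. \<exists>c\<in>{0<..<1}. \<exists>R>0. \<forall>n. \<forall>A\<subseteq>mspace (X n).
        \<alpha> * real (card (mspace (X n))) \<le> real (card A) \<and>
        real (card A) \<le> 1/2 * real (card (mspace (X n))) \<longrightarrow>
        real (card (metric_boundary (X n) R A)) > c * real (card A))"

definition uniformly_bounded_degree :: "(nat \<Rightarrow> ('a, 'b) pre_digraph) \<Rightarrow> bool" where
  "uniformly_bounded_degree X \<longleftrightarrow> (\<exists>D. \<forall>n. \<forall>v\<in>verts (X n). out_degree (X n) v \<le> D)"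

definition expanders :: "(nat \<Rightarrow> ('a, 'b) pre_digraph) \<Rightarrow> bool" where
  "expanders X \<longleftrightarrow>
     (\<forall>n. Digraph.graph (X n)) \<and>
     uniformly_bounded_degree X \<and>
     filterlim (\<lambda>n. card (verts (X n))) at_top sequentially \<and>
     (\<exists>c::real>0. \<forall>n. \<forall>A\<subseteq>verts (X n).
        A \<noteq> {} \<and> real (card A) \<le> 1/2 * real (card (verts (X n))) \<longrightarrow>
        real (card (graph_boundary (X n) A)) > c * real (card A))"

definition graph_automorphism ::
  "('a, 'b) pre_digraph \<Rightarrow> ('a, 'b, 'a, 'b) digraph_isomorphism \<Rightarrow> bool" where
  "graph_automorphism G h \<longleftrightarrow> pre_digraph.digraph_isomorphism G h \<and> app_iso h G = G"

definition vertex_transitive :: "('a, 'b) pre_digraph \<Rightarrow> bool" where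
  "vertex_transitive G \<longleftrightarrow>
     (\<forall>u\<in>verts G. \<forall>v\<in>verts G. \<exists>h. graph_automorphism G h \<and> iso_verts h u = v)"


lemma (in wf_digraph) awalk_cost_one: "awalk_cost (\<lambda>_. 1) p = real (length p)"
  by (induction p) auto

lemma (in wf_digraph) path_edist_le:
  "awalk u p v \<Longrightarrow> path_edist G u v \<le> ereal (real (length p))"
  unfolding path_edist_def by (metis min_cost_le_walk_cost awalk_cost_one)

lemma (in sym_digraph) rev_awalk:
  "awalk u p v \<Longrightarrow> \<exists>q. awalk v q u \<and> length q = length p"
proof (induction p arbitrary: u)
  case Nil
  then show ?case by (intro exI[of _ "[]"]) (auto simp: awalk_Nil_iff)
next
  case (Cons e p)
  then have e: "e \<in> arcs G" "u = tail G e" "awalk (head G e) p v"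
    by (auto simp: awalk_Cons_iff)
  obtain q where q: "awalk v q (head G e)" "length q = length p"
    using Cons.IH[OF e(3)] by blast
  obtain f where f: "f \<in> arcs G" "tail G f = head G e" "head G f = tail G e"
    using sym_arcs e(1) unfolding symmetric_conv by metis
  have "awalk (head G e) [f] u"
    using f e by (simp add: awalk_Cons_iff awalk_Nil_iff)
  then have "awalk v (q @ [f]) u"
    using q(1) awalk_appendI by blast
  with q(2) show ?case by (intro exI[of _ "q @ [f]"]) simp
qed

context
  fixes G :: "('a, 'b) pre_digraph"
  assumes G: "Digraph.graph G" and conn: "Digraph_Component.connected G"
begin

interpretation G: Digraph.graph G by (rule G)

lemma path_edist_attained:
  assumes "u \<in> verts G" "v \<in> verts G"
  shows "\<exists>p. G.awalk u p v \<and> path_edist G u v = ereal (real (length p))"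
proof -
  have "u \<rightarrow>\<^sup>*\<^bsub>with_proj (mk_symmetric G)\<^esub> v"
    using conn assms
    by (auto simp: Digraph_Component.connected_def strongly_connected_def)
  then have "u \<rightarrow>\<^sup>*\<^bsub>G\<^esub> v"
    using G.reachable_mk_symmetric_eq[OF G.sym_arcs] by blast
  then show ?thesis
    using G.min_cost_awalk[of u v "\<lambda>_. 1"]
    by (auto simp: path_edist_def G.awalk_cost_one intro: G.awalkI_apath)
qed

lemma path_edist_sym_le: "path_edist G u v \<le> path_edist G v u"
proof -
  have "path_edist G u v \<le> ereal (G.awalk_cost (\<lambda>_. 1) p)" if "G.awalk v p u" for p
    using G.rev_awalk[OF that] G.path_edist_le by (metis G.awalk_cost_one)
  then show ?thesis
    unfolding path_edist_def[of G] G.\<mu>_def by (auto intro!: INF_greatest)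
qed

lemma path_edist_nonneg: "0 \<le> path_edist G u v"
  unfolding path_edist_def G.\<mu>_def by (auto intro!: INF_greatest simp: G.awalk_cost_one)

lemma Metric_space_path: "Metric_space (verts G) (\<lambda>u v. real_of_ereal (path_edist G u v))"
proof
  fix x y z
  show "0 \<le> real_of_ereal (path_edist G x y)"
    by (simp add: path_edist_nonneg real_of_ereal_pos)
  show "real_of_ereal (path_edist G x y) = real_of_ereal (path_edist G y x)"
    by (rule arg_cong[OF order_antisym[OF path_edist_sym_le path_edist_sym_le]])
  show "(real_of_ereal (path_edist G x y) = 0) = (x = y)" if xy: "x \<in> verts G" "y \<in> verts G"
  proof
    assume "real_of_ereal (path_edist G x y) = 0"
    moreover obtain p where p: "G.awalk x p y" "path_edist G x y = ereal (real (length p))"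
      using path_edist_attained xy by blast
    ultimately show "x = y" by (auto simp: G.awalk_Nil_iff)
  next
    assume "x = y"
    then have "path_edist G x y \<le> 0"
      using G.path_edist_le[of x "[]" y] xy by (simp add: G.awalk_Nil_iff flip: zero_ereal_def)
    then have "path_edist G x y = 0"
      using path_edist_nonneg by (rule order_antisym)
    then show "real_of_ereal (path_edist G x y) = 0" by simp
  qed
  show "real_of_ereal (path_edist G x z)
      \<le> real_of_ereal (path_edist G x y) + real_of_ereal (path_edist G y z)"
    if xyz: "x \<in> verts G" "y \<in> verts G" "z \<in> verts G"
  proof -
    obtain p where p: "G.awalk x p y" "path_edist G x y = ereal (real (length p))"
      using path_edist_attained xyz by blast
    obtain q where q: "G.awalk y q z" "path_edist G y z = ereal (real (length q))"
      using path_edist_attained xyz by blast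
    obtain r where r: "G.awalk x r z" "path_edist G x z = ereal (real (length r))"
      using path_edist_attained xyz by blast
    show ?thesis
      using G.path_edist_le[OF G.awalk_appendI[OF p(1) q(1)]] p(2) q(2) r by simp
  qed
qed

lemma mspace_path_metric: "mspace (path_metric G) = verts G"
  unfolding path_metric_def by (rule Metric_space.mspace_metric[OF Metric_space_path])

lemma mdist_path_metric:
  assumes "u \<in> verts G" "v \<in> verts G"
  shows "ereal (mdist (path_metric G) u v) = path_edist G u v"
  using path_edist_attained[OF assms]
  by (auto simp: path_metric_def Metric_space.mdist_metric[OF Metric_space_path])

lemma metric_boundary_path_metric:
  assumes "A \<subseteq> verts G"
  shows "metric_boundary (path_metric G) 1 A = graph_boundary G A"
proof -
  have "(INF a\<in>A. ereal (mdist (path_metric G) x a)) = (INF a\<in>A. path_edist G x a)"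
    if "x \<in> verts G" for x
    using assms that by (intro INF_cong refl) (auto simp: mdist_path_metric)
  then show ?thesis
    by (auto simp: metric_boundary_def graph_boundary_def boundary_def mspace_path_metric)
qed

end

end

theory Submission
  imports Defs "HOL-Combinatorics.Permutations"
begin

text \<open>
  Only small sets are an issue. In a vertex-transitive graph with vertex set \<open>V\<close>, a random
  translate \<open>gA\<close> meets a set \<open>B\<close> in \<open>|A||B|/|V|\<close> points on average. So if \<open>A\<close> has a relatively
  small boundary, one can keep adding translates of \<open>A\<close>, each contributing at least \<open>|A|/2\<close> new
  points, until the union has between \<open>|V|/4\<close> and \<open>|V|/2\<close> points; its boundary ratio is at most
  twice that of \<open>A\<close>. Asymptotic expansion at the single scale \<open>\<alpha> = 1/4\<close> therefore bounds the
  boundary ratio of \<open>A\<close> from below; the passage from radius \<open>R\<close> to radius \<open>1\<close> costs a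
  bounded factor, because the degrees are bounded.
\<close>

section \<open>Translates under a transitive group\<close>

text \<open>Orbit-stabiliser by comparison: composing with an element that takes \<open>u\<close> to
  \<open>v\<close> embeds the transporter from \<open>a\<close> to \<open>u\<close> into the one
  from \<open>a\<close> to \<open>v\<close>. By transitivity this works in both directions, so the
  classes of \<open>\<Gamma>\<close> by the value at \<open>a\<close> all have the same
  size.\<close>

lemma card_transporter_eq:
  assumes "finite V" "finite \<Gamma>"
    and perm: "\<And>f. f \<in> \<Gamma> \<Longrightarrow> f permutes V"
    and comp: "\<And>f g. f \<in> \<Gamma> \<Longrightarrow> g \<in> \<Gamma> \<Longrightarrow> f \<circ> g \<in> \<Gamma>"
    and trans: "\<And>u v. u \<in> V \<Longrightarrow> v \<in> V \<Longrightarrow> \<exists>f\<in>\<Gamma>. f u = v"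
    and "a \<in> V" "b \<in> V"
  shows "card V * card {g \<in> \<Gamma>. g a = b} = card \<Gamma>"
proof -
  have le: "card {g \<in> \<Gamma>. g a = u} \<le> card {g \<in> \<Gamma>. g a = v}" if uv: "u \<in> V" "v \<in> V" for u v
  proof -
    obtain h where h: "h \<in> \<Gamma>" "h u = v"
      using trans uv by blast
    have "inj h"
      using perm h(1) permutes_inj by blast
    then have "inj_on ((\<circ>) h) {g \<in> \<Gamma>. g a = u}"
      by (intro inj_on_subset[OF fun.inj_map] subset_UNIV)
    moreover have "(\<circ>) h ` {g \<in> \<Gamma>. g a = u} \<subseteq> {g \<in> \<Gamma>. g a = v}"
      using comp h by auto
    ultimately show ?thesis
      using \<open>finite \<Gamma>\<close> by (intro card_inj_on_le) auto
  qed
  have "\<Gamma> = (\<Union>v\<in>V. {g \<in> \<Gamma>. g a = v})"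
    using perm \<open>a \<in> V\<close> by (auto simp: permutes_in_image)
  then have "card \<Gamma> = card (\<Union>v\<in>V. {g \<in> \<Gamma>. g a = v})"
    by simp
  also have "\<dots> = (\<Sum>v\<in>V. card {g \<in> \<Gamma>. g a = v})"
    using \<open>finite V\<close> \<open>finite \<Gamma>\<close> by (intro card_UN_disjoint) auto
  also have "\<dots> = (\<Sum>v\<in>V. card {g \<in> \<Gamma>. g a = b})"
    using le \<open>b \<in> V\<close> by (intro sum.cong refl order_antisym) auto
  finally show ?thesis
    by simp
qed

text \<open>Averaging: summed over all \<open>g\<close>, the intersections count the triples
  \<open>(g, a, b)\<close> with \<open>g a = b\<close>. Each pair \<open>(a, b)\<close> contributes
  \<open>card \<Gamma> / card V\<close>, so the mean is \<open>card A * card B / card V\<close>, and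
  some \<open>g\<close> does not exceed it.\<close>

lemma exists_translate_card_Int_le:
  assumes "finite V" "V \<noteq> {}" "finite \<Gamma>"
    and perm: "\<And>f. f \<in> \<Gamma> \<Longrightarrow> f permutes V"
    and comp: "\<And>f g. f \<in> \<Gamma> \<Longrightarrow> g \<in> \<Gamma> \<Longrightarrow> f \<circ> g \<in> \<Gamma>"
    and trans: "\<And>u v. u \<in> V \<Longrightarrow> v \<in> V \<Longrightarrow> \<exists>f\<in>\<Gamma>. f u = v"
    and AB: "A \<subseteq> V" "B \<subseteq> V"
  shows "\<exists>g\<in>\<Gamma>. card V * card (g ` A \<inter> B) \<le> card A * card B"
proof (rule ccontr)
  assume "\<not> ?thesis"
  then have gt: "card A * card B < card V * card (g ` A \<inter> B)" if "g \<in> \<Gamma>" for g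
    using that by (simp add: not_le)
  have fin: "finite A" "finite B"
    using AB \<open>finite V\<close> finite_subset by auto
  have "\<Gamma> \<noteq> {}"
    using trans \<open>V \<noteq> {}\<close> by blast
  have "card (g ` A \<inter> B) = (\<Sum>a\<in>A. \<Sum>b\<in>B. of_bool (g a = b))" if "g \<in> \<Gamma>" for g
  proof -
    have "inj_on g {a \<in> A. g a \<in> B}"
      using perm that permutes_inj inj_on_subset by blast
    moreover have "g ` A \<inter> B = g ` {a \<in> A. g a \<in> B}"
      by auto
    ultimately have "card (g ` A \<inter> B) = card {a \<in> A. g a \<in> B}"
      by (simp add: card_image)
    also have "\<dots> = (\<Sum>a\<in>A. of_bool (g a \<in> B))"
      using fin by (simp add: of_bool_def sum.If_cases Int_def)
    also have "\<dots> = (\<Sum>a\<in>A. \<Sum>b\<in>B. of_bool (g a = b))"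
      using fin by (simp add: of_bool_def)
    finally show ?thesis .
  qed
  then have "(\<Sum>g\<in>\<Gamma>. card V * card (g ` A \<inter> B))
      = (\<Sum>g\<in>\<Gamma>. \<Sum>a\<in>A. \<Sum>b\<in>B. card V * of_bool (g a = b))"
    by (simp add: sum_distrib_left)
  also have "\<dots> = (\<Sum>a\<in>A. \<Sum>b\<in>B. \<Sum>g\<in>\<Gamma>. card V * of_bool (g a = b))"
    by (subst sum.swap) (intro sum.cong refl sum.swap)
  also have "\<dots> = (\<Sum>a\<in>A. \<Sum>b\<in>B. card V * card {g \<in> \<Gamma>. g a = b})"
    using \<open>finite \<Gamma>\<close> by (simp add: of_bool_def sum.If_cases Int_def flip: sum_distrib_left)
  also have "\<dots> = (\<Sum>a\<in>A. \<Sum>b\<in>B. card \<Gamma>)"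
    using AB by (intro sum.cong refl card_transporter_eq[OF assms(1,3) perm comp trans]) auto
  also have "\<dots> = (\<Sum>g\<in>\<Gamma>. card A * card B)"
    by simp
  also have "\<dots> < (\<Sum>g\<in>\<Gamma>. card V * card (g ` A \<inter> B))"
    using \<open>finite \<Gamma>\<close> \<open>\<Gamma> \<noteq> {}\<close> gt by (intro sum_strict_mono) auto
  finally show False
    by simp
qed

section \<open>Boundaries of unions of translates\<close>

text \<open>Only the vertices and the adjacency relation are kept. Through \<open>permutes\<close>
  the maps are the identity outside \<open>V\<close>, so there are finitely many when
  \<open>V\<close> is finite.\<close>

definition automorphisms :: "'a set \<Rightarrow> ('a \<times> 'a) set \<Rightarrow> ('a \<Rightarrow> 'a) set" where
  "automorphisms V E = {f. f permutes V \<and> map_prod f f ` E = E}"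

lemma automorphisms_comp:
  assumes "f \<in> automorphisms V E" "g \<in> automorphisms V E"
  shows "f \<circ> g \<in> automorphisms V E"
proof -
  have "map_prod (f \<circ> g) (f \<circ> g) ` E = map_prod f f ` map_prod g g ` E"
    by (metis image_comp map_prod_compose)
  then show ?thesis
    using assms by (auto simp: automorphisms_def intro: permutes_compose)
qed

text \<open>Invariance of \<open>E\<close> makes the image under \<open>f\<close> commute with
  taking neighbours, and injectivity makes it commute with set difference.\<close>

lemma card_boundary_translate:
  assumes "f \<in> automorphisms V E"
  shows "card (E `` (f ` A) - f ` A) = card (E `` A - A)"
proof -
  have inj: "inj f" and E: "map_prod f f ` E = E"
    using assms permutes_inj by (auto simp: automorphisms_def)
  have "E `` (f ` A) = (map_prod f f ` E) `` (f ` A)"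
    by (simp only: E)
  also have "\<dots> = f ` (E `` A)"
    using inj by (force dest: injD)
  finally have "E `` (f ` A) - f ` A = f ` (E `` A - A)"
    using inj by (simp add: image_set_diff)
  then show ?thesis
    using inj by (simp add: card_image inj_on_subset)
qed

text \<open>Among the sets of at most half size whose boundary ratio is at most twice that of
  \<open>A\<close>, take one of largest cardinality. Below a quarter of \<open>V\<close> it could be
  enlarged by a translate of \<open>A\<close>, so \<open>exp\<close> applies to it.\<close>

lemma small_set_expansion:
  fixes c :: real
  assumes "finite V" and E: "E \<subseteq> V \<times> V"
    and trans: "\<And>u v. u \<in> V \<Longrightarrow> v \<in> V \<Longrightarrow> \<exists>f\<in>automorphisms V E. f u = v"
    and exp: "\<And>B. B \<subseteq> V \<Longrightarrow> card V \<le> 4 * card B \<Longrightarrow> 2 * card B \<le> card V \<Longrightarrow>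
      c * card B < card (E `` B - B)"
    and A: "A \<subseteq> V" "A \<noteq> {}" "2 * card A \<le> card V"
  shows "c * card A < 2 * card (E `` A - A)"
proof -
  \<comment> \<open>The last condition is the bound on the boundary ratio, multiplied out to stay in
    the natural numbers.\<close>
  define S where "S = {B. B \<subseteq> V \<and> 2 * card B \<le> card V \<and>
    card A * card (E `` B - B) \<le> 2 * card (E `` A - A) * card B}"
  have fin: "finite B" if "B \<subseteq> V" for B
    using that \<open>finite V\<close> finite_subset by blast
  have A0: "card A > 0"
    using A fin by (simp add: card_gt_0_iff)
  have "A \<in> S"
    using A by (simp add: S_def)
  moreover have "finite S"
    using \<open>finite V\<close> by (auto simp: S_def)
  ultimately obtain B where B: "B \<in> S" and max: "\<And>B'. B' \<in> S \<Longrightarrow> card B' \<le> card B"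
    using finite_has_maximal[of "card ` S"]
    by (metis empty_iff finite_imageI image_eqI image_iff nle_le)
  have BV: "B \<subseteq> V" "2 * card B \<le> card V"
    "card A * card (E `` B - B) \<le> 2 * card (E `` A - A) * card B"
    using B by (auto simp: S_def)
  have AB: "card A \<le> card B"
    using max \<open>A \<in> S\<close> .
  have "card V \<le> 4 * card B"
  proof (rule ccontr)
    assume small: "\<not> ?thesis"
    have "\<exists>g\<in>automorphisms V E. card V * card (g ` A \<inter> B) \<le> card A * card B"
    proof (rule exists_translate_card_Int_le[OF \<open>finite V\<close> _ _ _ automorphisms_comp trans A(1) BV(1)])
      show "finite (automorphisms V E)"
        using finite_permutations[OF \<open>finite V\<close>] by (simp add: automorphisms_def)
      show "V \<noteq> {}"
        using A by blast
      show "f permutes V" if "f \<in> automorphisms V E" for f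
        using that by (simp add: automorphisms_def)
    qed
    then obtain g where g: "g \<in> automorphisms V E"
      and meet: "card V * card (g ` A \<inter> B) \<le> card A * card B"
      by blast
    have "g permutes V"
      using g by (simp add: automorphisms_def)
    then have gA: "g ` A \<subseteq> V" "card (g ` A) = card A"
      using A(1) permutes_image permutes_inj by (blast, metis card_image inj_on_subset subset_UNIV)
    let ?C = "B \<union> g ` A"
    \<comment> \<open>As \<open>B\<close> fills at most half of \<open>V\<close>, the translate has
      at most half of its points in \<open>B\<close>.\<close>
    have "card V * (2 * card (g ` A \<inter> B)) \<le> card A * (2 * card B)"
      using meet by (simp add: ac_simps)
    also have "\<dots> \<le> card A * card V"
      using BV(2) by (rule mult_left_mono) simp
    finally have "2 * card (g ` A \<inter> B) \<le> card A"
      using small by (simp add: ac_simps)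
    moreover have "card ?C + card (g ` A \<inter> B) = card B + card A"
      using card_Un_Int[of B "g ` A"] fin gA BV(1) by (simp add: Int_commute)
    ultimately have C: "2 * card B + card A \<le> 2 * card ?C" "card ?C \<le> card B + card A"
      by simp_all
    have "E `` ?C - ?C \<subseteq> (E `` B - B) \<union> (E `` (g ` A) - g ` A)"
      by auto
    then have "card (E `` ?C - ?C) \<le> card ((E `` B - B) \<union> (E `` (g ` A) - g ` A))"
      using E by (intro card_mono fin) auto
    also have "\<dots> \<le> card (E `` B - B) + card (E `` A - A)"
      using card_Un_le card_boundary_translate[OF g] by metis
    finally have "card A * card (E `` ?C - ?C)
        \<le> card A * card (E `` B - B) + card A * card (E `` A - A)"
      by (metis add_mult_distrib2 mult_le_mono2)
    \<comment> \<open>The factor 2 in \<open>S\<close> pays off here: one more copy of the boundary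
      of \<open>A\<close> is matched by the gain of at least \<open>card A / 2\<close>
      points.\<close>
    also have "\<dots> \<le> card (E `` A - A) * (2 * card B + card A)"
      using BV(3) by (simp add: algebra_simps)
    also have "\<dots> \<le> card (E `` A - A) * (2 * card ?C)"
      using C(1) by (rule mult_left_mono) simp
    \<comment> \<open>The union is still at most half of \<open>V\<close>: its size is at most
      \<open>card B + card A\<close>, hence at most \<open>2 * card B\<close>, and
      \<open>4 * card B < card V\<close>.\<close>
    finally have "?C \<in> S"
      using BV(1) gA C AB small by (simp add: S_def ac_simps)
    then show False
      using max C A0 by fastforce
  qed
  then have "c * card B < card (E `` B - B)"
    using exp BV by blast
  then have "card A * (c * card B) < card A * real (card (E `` B - B))"
    using A0 by simp
  also have "\<dots> \<le> 2 * card (E `` A - A) * real (card B)"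
    using BV(3) by (metis of_nat_le_iff of_nat_mult of_nat_numeral)
  finally have "(c * card A) * card B < (2 * card (E `` A - A)) * card B"
    by (simp add: ac_simps)
  then show ?thesis
    by (simp add: mult_less_cancel_right)
qed

section \<open>Boundaries in graphs\<close>

context
  fixes G :: "('a, 'b) pre_digraph"
  assumes G: "Digraph.graph G" and conn: "Digraph_Component.connected G"
begin

interpretation G: Digraph.graph G by (rule G)

text \<open>The infimum over a finite non-empty set is attained, and so is each distance, by a
  shortest walk.\<close>

lemma boundary_path_edist_iff:
  assumes "A \<subseteq> verts G"
  shows "x \<in> boundary (verts G) (path_edist G) R A \<longleftrightarrow>
    x \<in> verts G - A \<and> (\<exists>a\<in>A. \<exists>p. G.awalk x p a \<and> real (length p) \<le> R)"
proof
  assume x: "x \<in> boundary (verts G) (path_edist G) R A"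
  have "finite A"
    using assms G.finite_verts by (rule finite_subset)
  \<comment> \<open>Over the empty set the infimum is \<infinity>, which exceeds every real
    \<open>R\<close>.\<close>
  have "A \<noteq> {}"
    using x by (auto simp: boundary_def top_ereal_def)
  with \<open>finite A\<close> have "(INF a\<in>A. path_edist G x a) \<in> path_edist G x ` A"
    by (metis Min_Inf Min_in finite_imageI image_is_empty)
  then obtain a where "a \<in> A" "path_edist G x a \<le> ereal R"
    using x by (auto simp: boundary_def)
  moreover have xV: "x \<in> verts G - A"
    using x by (simp add: boundary_def)
  moreover obtain p where "G.awalk x p a" "path_edist G x a = ereal (real (length p))"
    using path_edist_attained[OF G conn, of x a] assms \<open>a \<in> A\<close> xV by blast
  ultimately show "x \<in> verts G - A \<and> (\<exists>a\<in>A. \<exists>p. G.awalk x p a \<and> real (length p) \<le> R)"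
    by auto
next
  assume "x \<in> verts G - A \<and> (\<exists>a\<in>A. \<exists>p. G.awalk x p a \<and> real (length p) \<le> R)"
  then obtain a p where *: "x \<in> verts G - A" "a \<in> A" "G.awalk x p a" "real (length p) \<le> R"
    by blast
  have "(INF a\<in>A. path_edist G x a) \<le> ereal (real (length p))"
    using *(2) G.path_edist_le[OF *(3)] by (rule INF_lower2)
  then show "x \<in> boundary (verts G) (path_edist G) R A"
    using * by (auto simp: boundary_def intro: order_trans)
qed

lemma metric_boundary_path_metric_eq:
  assumes "A \<subseteq> verts G"
  shows "metric_boundary (path_metric G) R A = boundary (verts G) (path_edist G) R A"
proof -
  have "(INF a\<in>A. ereal (mdist (path_metric G) x a)) = (INF a\<in>A. path_edist G x a)"
    if "x \<in> verts G" for x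
    using assms that by (intro INF_cong refl) (auto simp: mdist_path_metric[OF G conn])
  then show ?thesis
    by (auto simp: metric_boundary_def boundary_def mspace_path_metric[OF G conn])
qed

lemma awalk_Cons_arcs_ends:
  assumes "G.awalk x (e # p) a"
  obtains y where "(x, y) \<in> arcs_ends G" "(y, x) \<in> arcs_ends G" "G.awalk y p a"
proof
  show "(x, head G e) \<in> arcs_ends G" "G.awalk (head G e) p a"
    using assms by (auto simp: G.awalk_Cons_iff arcs_ends_conv)
  then show "(head G e, x) \<in> arcs_ends G"
    using arcs_ends_symmetric[OF G.sym_arcs] by blast
qed

text \<open>A walk of length at most 1 from outside \<open>A\<close> into \<open>A\<close> is a
  single arc, and arcs come in opposite pairs. This links the metric boundary to the relational one
  used for translates.\<close>

lemma graph_boundary_eq: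
  assumes "A \<subseteq> verts G"
  shows "graph_boundary G A = arcs_ends G `` A - A"
proof (intro set_eqI iffI)
  fix x assume "x \<in> graph_boundary G A"
  then obtain a p where *: "x \<in> verts G - A" "a \<in> A" "G.awalk x p a" "length p \<le> 1"
    unfolding graph_boundary_def boundary_path_edist_iff[OF assms] by auto
  then obtain e where p: "p = [e]"
    by (cases p) (auto simp: G.awalk_Nil_iff)
  obtain y where "(y, x) \<in> arcs_ends G" "G.awalk y [] a"
    using awalk_Cons_arcs_ends *(3) unfolding p by blast
  then show "x \<in> arcs_ends G `` A - A"
    using * by (auto simp: G.awalk_Nil_iff)
next
  fix x assume "x \<in> arcs_ends G `` A - A"
  then obtain a where *: "(x, a) \<in> arcs_ends G" "a \<in> A" "x \<notin> A"
    using arcs_ends_symmetric[OF G.sym_arcs] by blast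
  then obtain e where "e \<in> arcs G" "tail G e = x" "head G e = a"
    by blast
  then have "G.awalk x [e] a"
    by (auto simp: G.awalk_Cons_iff G.awalk_Nil_iff)
  then show "x \<in> graph_boundary G A"
    using * G.adj_in_verts(1)[OF *(1)]
    unfolding graph_boundary_def boundary_path_edist_iff[OF assms]
    by (auto intro!: bexI[of _ a] exI[of _ "[e]"])
qed

text \<open>Its \<open>k\<close>-fold iterate is the ball of radius \<open>k\<close> about
  \<open>S\<close>, which serves to compare boundaries of different radii.\<close>

definition closed_neighbourhood :: "'a set \<Rightarrow> 'a set" where
  "closed_neighbourhood S = S \<union> arcs_ends G `` S"

lemma card_closed_neighbourhood_le:
  assumes deg: "\<And>v. v \<in> verts G \<Longrightarrow> out_degree G v \<le> D" and "S \<subseteq> verts G"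
  shows "card (closed_neighbourhood S) \<le> (D + 1) * card S"
proof -
  have "finite S"
    using assms(2) G.finite_verts by (rule finite_subset)
  have nb: "card (arcs_ends G `` {v}) \<le> D" if "v \<in> S" for v
  proof -
    have "arcs_ends G `` {v} = head G ` out_arcs G v"
      by (auto simp: arcs_ends_conv)
    then have "card (arcs_ends G `` {v}) \<le> card (out_arcs G v)"
      by (simp add: G.finite_out_arcs card_image_le)
    then show ?thesis
      using deg[of v] that assms(2) by (auto simp: out_degree_def)
  qed
  have "arcs_ends G `` S = (\<Union>v\<in>S. arcs_ends G `` {v})"
    by auto
  then have "card (arcs_ends G `` S) \<le> (\<Sum>v\<in>S. card (arcs_ends G `` {v}))"
    using \<open>finite S\<close> by (metis card_UN_le)
  also have "\<dots> \<le> (\<Sum>v\<in>S. D)"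
    using nb by (rule sum_mono)
  finally have "card S + card (arcs_ends G `` S) \<le> (D + 1) * card S"
    by (simp add: ac_simps)
  then show ?thesis
    using card_Un_le order_trans unfolding closed_neighbourhood_def by blast
qed

lemma closed_neighbourhood_iterate_subset:
  "S \<subseteq> verts G \<Longrightarrow> (closed_neighbourhood ^^ k) S \<subseteq> verts G"
  by (induction k) (auto simp: closed_neighbourhood_def G.adj_in_verts)

lemma card_closed_neighbourhood_iterate_le:
  assumes deg: "\<And>v. v \<in> verts G \<Longrightarrow> out_degree G v \<le> D" and S: "S \<subseteq> verts G"
  shows "card ((closed_neighbourhood ^^ k) S) \<le> (D + 1) ^ k * card S"
proof (induction k)
  case (Suc k)
  have "card ((closed_neighbourhood ^^ Suc k) S) \<le> (D + 1) * card ((closed_neighbourhood ^^ k) S)"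
    using card_closed_neighbourhood_le[OF deg closed_neighbourhood_iterate_subset[OF S]] by simp
  also have "\<dots> \<le> (D + 1) * ((D + 1) ^ k * card S)"
    using Suc by (rule mult_le_mono2)
  finally show ?case
    by (simp add: ac_simps)
qed simp

lemma closed_neighbourhood_iterate_mono:
  "j \<le> k \<Longrightarrow> (closed_neighbourhood ^^ j) S \<subseteq> (closed_neighbourhood ^^ k) S"
  by (rule lift_Suc_mono_le) (auto simp: closed_neighbourhood_def)

text \<open>A walk that enters \<open>A\<close> from outside passes through the boundary just before
  entering. In the induction, either the next vertex lies in \<open>A\<close> and \<open>x\<close>
  itself is a boundary point, or the next vertex is already near the boundary.\<close>

lemma awalk_into_imp_near_boundary:
  assumes "G.awalk x p a" "a \<in> A" "x \<notin> A"
  shows "x \<in> (closed_neighbourhood ^^ length p) (arcs_ends G `` A - A)"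
  using assms
proof (induction p arbitrary: x)
  case Nil
  then show ?case
    by (auto simp: G.awalk_Nil_iff)
next
  case (Cons e p)
  obtain y where y: "(y, x) \<in> arcs_ends G" "G.awalk y p a"
    using awalk_Cons_arcs_ends Cons.prems(1) by blast
  show ?case
  proof (cases "y \<in> A")
    case True
    \<comment> \<open>The boundary is the iterate of order 0, hence contained in all later
      ones.\<close>
    then show ?thesis
      using y(1) Cons.prems(3)
        closed_neighbourhood_iterate_mono[of 0 "length (e # p)" "arcs_ends G `` A - A"]
      by (auto simp del: funpow.simps(2))
  next
    case False
    then have "y \<in> (closed_neighbourhood ^^ length p) (arcs_ends G `` A - A)"
      using Cons.IH y(2) Cons.prems(2) by blast
    then show ?thesis
      using y(1) by (auto simp: closed_neighbourhood_def [of "(closed_neighbourhood ^^ length p) _"])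
  qed
qed

text \<open>The boundary of radius \<open>R\<close> lies in a ball about the boundary of radius 1,
  and each unit of radius multiplies the size by at most \<open>D + 1\<close>. Walk lengths are
  integers, whence the floor.\<close>

lemma card_metric_boundary_le:
  assumes deg: "\<And>v. v \<in> verts G \<Longrightarrow> out_degree G v \<le> D" and A: "A \<subseteq> verts G"
  shows "card (metric_boundary (path_metric G) R A)
    \<le> (D + 1) ^ nat \<lfloor>R\<rfloor> * card (arcs_ends G `` A - A)"
proof -
  let ?B = "arcs_ends G `` A - A"
  have B: "?B \<subseteq> verts G"
    by (auto simp: G.adj_in_verts)
  have "metric_boundary (path_metric G) R A \<subseteq> (closed_neighbourhood ^^ nat \<lfloor>R\<rfloor>) ?B"
  proof
    fix x assume "x \<in> metric_boundary (path_metric G) R A"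
    then obtain a p where *: "x \<notin> A" "a \<in> A" "G.awalk x p a" "real (length p) \<le> R"
      unfolding metric_boundary_path_metric_eq[OF A] boundary_path_edist_iff[OF A] by auto
    have "length p \<le> nat \<lfloor>R\<rfloor>"
      using *(4) by (simp add: le_nat_floor)
    then show "x \<in> (closed_neighbourhood ^^ nat \<lfloor>R\<rfloor>) ?B"
      using awalk_into_imp_near_boundary[OF *(3,2,1)] closed_neighbourhood_iterate_mono by blast
  qed
  then have "card (metric_boundary (path_metric G) R A)
      \<le> card ((closed_neighbourhood ^^ nat \<lfloor>R\<rfloor>) ?B)"
    using finite_subset[OF closed_neighbourhood_iterate_subset[OF B] G.finite_verts]
    by (intro card_mono)
  also have "\<dots> \<le> (D + 1) ^ nat \<lfloor>R\<rfloor> * card ?B"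
    using deg B by (rule card_closed_neighbourhood_iterate_le)
  finally show ?thesis .
qed

text \<open>Turns an isomorphism record, with its separate maps on vertices and arcs, into a
  permutation that preserves adjacency.\<close>

lemma vertex_transitive_automorphisms:
  assumes "vertex_transitive G" "u \<in> verts G" "v \<in> verts G"
  shows "\<exists>f\<in>automorphisms (verts G) (arcs_ends G). f u = v"
proof -
  obtain h where h: "G.digraph_isomorphism h" "app_iso h G = G" "iso_verts h u = v"
    using assms by (auto simp: vertex_transitive_def graph_automorphism_def)
  have img: "iso_verts h ` verts G = verts G" "iso_arcs h ` arcs G = arcs G"
    "iso_tail h = tail G" "iso_head h = head G"
    using arg_cong[OF h(2), of verts] arg_cong[OF h(2), of arcs]
      arg_cong[OF h(2), of tail] arg_cong[OF h(2), of head] by simp_all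
  \<comment> \<open>\<open>iso_verts h\<close> may be arbitrary off the graph, whereas
    \<open>permutes\<close> requires the identity there.\<close>
  define f where "f x = (if x \<in> verts G then iso_verts h x else x)" for x
  have "bij_betw (iso_verts h) (verts G) (verts G)"
    using img h(1) G.digraph_isomorphism_inj_on_verts by (simp add: bij_betw_def)
  then have "bij_betw f (verts G) (verts G)"
    by (simp add: f_def cong: bij_betw_cong)
  then have "f permutes verts G"
    by (rule bij_imp_permutes) (simp add: f_def)
  moreover have "map_prod f f ` arcs_ends G = arcs_ends G"
  proof -
    have "map_prod f f ` arcs_ends G = (\<lambda>e. (f (tail G e), f (head G e))) ` arcs G"
      by (simp add: arcs_ends_conv image_image)
    also have "\<dots> = (\<lambda>e. (tail G (iso_arcs h e), head G (iso_arcs h e))) ` arcs G"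
      using G.iso_verts_tail[OF h(1)] G.iso_verts_head[OF h(1)] img(3,4)
      by (intro image_cong refl) (simp add: f_def)
    also have "\<dots> = (\<lambda>e. (tail G e, head G e)) ` iso_arcs h ` arcs G"
      by (simp add: image_image)
    also have "\<dots> = arcs_ends G"
      by (simp add: img arcs_ends_conv)
    finally show ?thesis .
  qed
  ultimately show ?thesis
    using h(3) assms(2) by (auto simp: automorphisms_def f_def)
qed

end

section \<open>Asymptotic expanders and expanders\<close>

lemma expanders_imp_asymptotic_expanders:
  fixes X :: "nat \<Rightarrow> ('a, 'b) pre_digraph"
  assumes X: "\<And>n. Digraph.graph (X n)" "\<And>n. Digraph_Component.connected (X n)"
    and "expanders X"
  shows "asymptotic_expanders (\<lambda>n. path_metric (X n))"
proof -
  have ms: "mspace (path_metric (X n)) = verts (X n)" for n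
    using mspace_path_metric X by blast
  have fin: "finite (verts (X n))" for n
    using X(1) by (meson digraph.axioms(1) fin_digraph.finite_verts graph.axioms(1))
  have ne: "card (verts (X n)) > 0" for n
    using X(2)[of n] fin[of n]
    by (simp add: Digraph_Component.connected_def strongly_connected_def card_gt_0_iff)
  obtain c :: real where c: "c > 0" and exp: "\<And>n A. A \<subseteq> verts (X n) \<Longrightarrow> A \<noteq> {} \<Longrightarrow>
      real (card A) \<le> 1/2 * real (card (verts (X n))) \<Longrightarrow>
      real (card (graph_boundary (X n) A)) > c * real (card A)"
    using assms(3) by (auto simp: expanders_def)
  \<comment> \<open>An asymptotic expansion constant must be less than 1. This one, with radius 1,
    serves every \<alpha>.\<close>
  let ?c = "min c (1/2)"
  have "?c * real (card A) < real (card (metric_boundary (path_metric (X n)) 1 A))"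
    if \<alpha>: "\<alpha> > 0" and A: "A \<subseteq> verts (X n)" "\<alpha> * real (card (verts (X n))) \<le> real (card A)"
      "real (card A) \<le> 1/2 * real (card (verts (X n)))" for \<alpha> :: real and n A
  proof -
    \<comment> \<open>The lower bound on \<open>card A\<close> excludes the empty set, to which
      expansion does not apply.\<close>
    have "0 < \<alpha> * real (card (verts (X n)))"
      using \<alpha> ne by simp
    then have "A \<noteq> {}"
      using A(2) by force
    have "?c * real (card A) \<le> c * real (card A)"
      by (intro mult_right_mono) auto
    also have "\<dots> < real (card (graph_boundary (X n) A))"
      using exp A \<open>A \<noteq> {}\<close> by blast
    finally show ?thesis
      using metric_boundary_path_metric[OF X A(1)] by simp
  qed
  moreover have "?c \<in> {0<..<1}"
    using c by auto
  moreover have "filterlim (\<lambda>n. card (verts (X n))) at_top sequentially"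
    using assms(3) by (simp add: expanders_def)
  ultimately show ?thesis
    unfolding asymptotic_expanders_def ms using fin
    by (metis greaterThanAtMost_iff zero_less_one)
qed

lemma asymptotic_expanders_imp_expanders:
  fixes X :: "nat \<Rightarrow> ('a, 'b) pre_digraph"
  assumes X: "\<And>n. Digraph.graph (X n)" "\<And>n. Digraph_Component.connected (X n)"
    and trans: "\<And>n. vertex_transitive (X n)"
    and deg: "uniformly_bounded_degree X"
    and asym: "asymptotic_expanders (\<lambda>n. path_metric (X n))"
  shows "expanders X"
proof -
  have ms: "mspace (path_metric (X n)) = verts (X n)" for n
    using mspace_path_metric X by blast
  have fin: "finite (verts (X n))" for n
    using asym by (auto simp: asymptotic_expanders_def ms)
  \<comment> \<open>The scale 1/4 is the lower threshold in the hypothesis \<open>exp\<close> of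
    \<open>small_set_expansion\<close>.\<close>
  have "(1/4 :: real) \<in> {0<..1/2}"
    by simp
  then obtain c R :: real where c: "c > 0" and exp: "\<And>n A. A \<subseteq> verts (X n) \<Longrightarrow>
      1/4 * real (card (verts (X n))) \<le> real (card A) \<Longrightarrow>
      real (card A) \<le> 1/2 * real (card (verts (X n))) \<Longrightarrow>
      real (card (metric_boundary (path_metric (X n)) R A)) > c * real (card A)"
    using asym unfolding asymptotic_expanders_def ms by (metis greaterThanLessThan_iff)
  obtain D where D: "\<And>n v. v \<in> verts (X n) \<Longrightarrow> out_degree (X n) v \<le> D"
    using deg by (auto simp: uniformly_bounded_degree_def)
  define K where "K = (D + 1) ^ nat \<lfloor>R\<rfloor>"
  have K: "real K > 0"
    by (simp add: K_def)
  \<comment> \<open>The factor \<open>K\<close> is the cost of passing from radius \<open>R\<close>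
    to radius 1, and 2 is the loss in \<open>small_set_expansion\<close>.\<close>
  have "c / (2 * K) * real (card A) < real (card (graph_boundary (X n) A))"
    if A: "A \<subseteq> verts (X n)" "A \<noteq> {}" "real (card A) \<le> 1/2 * real (card (verts (X n)))" for n A
  proof -
    let ?E = "arcs_ends (X n)"
    have "c / K * card A < 2 * card (?E `` A - A)"
    proof (rule small_set_expansion[OF fin])
      show "?E \<subseteq> verts (X n) \<times> verts (X n)"
        using X(1)[of n] unfolding graph_def digraph_def fin_digraph_def
        by (auto dest: wf_digraph.adj_in_verts)
      show "\<exists>f\<in>automorphisms (verts (X n)) ?E. f u = v"
        if "u \<in> verts (X n)" "v \<in> verts (X n)" for u v
        using vertex_transitive_automorphisms[OF X trans that] .
      show "c / K * card B < card (?E `` B - B)"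
        if B: "B \<subseteq> verts (X n)" "card (verts (X n)) \<le> 4 * card B"
          "2 * card B \<le> card (verts (X n))" for B
      proof -
        have "c * card B < card (metric_boundary (path_metric (X n)) R B)"
          using B by (intro exp) linarith+
        also have "\<dots> \<le> real K * card (?E `` B - B)"
          using card_metric_boundary_le[OF X D B(1), of R]
          unfolding K_def by (metis of_nat_le_iff of_nat_mult)
        finally show ?thesis
          using K by (simp add: field_simps)
      qed
      show "2 * card A \<le> card (verts (X n))"
        using A(3) by linarith
    qed (use A in auto)
    then show ?thesis
      using graph_boundary_eq[OF X A(1)] by (simp add: field_simps)
  qed
  moreover have "c / (2 * K) > 0"
    using c K by simp
  moreover have "filterlim (\<lambda>n. card (verts (X n))) at_top sequentially"
    using asym by (simp add: asymptotic_expanders_def ms)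
  ultimately show ?thesis
    unfolding expanders_def using X(1) deg by blast
qed

theorem theoremF:
  fixes X :: "nat \<Rightarrow> ('a, 'b) pre_digraph"
  assumes "\<And>n. Digraph.graph (X n)"
    and "\<And>n. Digraph_Component.connected (X n)"
    and "\<And>n. vertex_transitive (X n)"
    and "uniformly_bounded_degree X"
  shows "asymptotic_expanders (\<lambda>n. path_metric (X n)) \<longleftrightarrow> expanders X"
  using asymptotic_expanders_imp_expanders[OF assms] expanders_imp_asymptotic_expanders[of X, OF assms(1,2)]
  by blast

end
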